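(* Let $\mathfrak{p}=\{X\in \mathrm{Sym}(3,\mathbb{R}) \mid \operatorname{tr} X=0\}$ be the space of real symmetric trace-free $3\times 3$-matrices and let $K=\mathrm{SO}(3,\mathbb{R})$ act on $\mathfrak{p}$ by conjugation, $k\cdot X=kXk^{-1}$. Define $$W:=\left\{ \begin{pmatrix} \mu & 0 & \lambda \\ 0 & -\mu & 0\\ \lambda & 0 & 0\end{pmatrix}\ \middle|\ \mu,\lambda\in\mathbb{R}\right\}.$$ Then $K\cdot W=\mathfrak{p}$.
   Context: For a subset $W\subset\mathfrak{p}$, $K\cdot W:=\{k\cdot X\mid k\in K,\ X\in W\}$. *)

theory Defs
  imports "HOL-Analysis.Analysis"
begin

definition sym0 :: "(real^3^3) set" where
  "sym0 = {X. transpose X = X \<and> trace X = 0}"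

definition SO3 :: "(real^3^3) set" where
  "SO3 = {k. rotation_matrix k}"

definition conj_act :: "real^3^3 \<Rightarrow> real^3^3 \<Rightarrow> real^3^3" where
  "conj_act k X = k ** X ** matrix_inv k"

definition saturation :: "(real^3^3) set \<Rightarrow> (real^3^3) set" where
  "saturation W = {conj_act k X | k X. k \<in> SO3 \<and> X \<in> W}"

definition W_mat :: "real \<Rightarrow> real \<Rightarrow> real^3^3" where
  "W_mat m l =
     vector [vector [m, 0, l],
             vector [0, - m, 0],
             vector [l, 0, 0]]"

definition W_sub :: "(real^3^3) set" where
  "W_sub = {W_mat m l | m l. True}"

end

theory Submission
  imports Defs
begin

text \<open>
  The inclusion of \<open>K \<cdot> W\<close> in the symmetric trace-free matrices is the invariance of symmetry and trace
  under orthogonal conjugation. For the converse, in a positively oriented orthonormal frame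
  \<open>u, v, w\<close> the symmetric bilinear form of \<open>X\<close> has the matrix of the numbers \<open>u \<bullet> X u\<close>, \<open>u \<bullet> X v\<close>
  and so on, and this matrix is conjugate to \<open>X\<close> by a rotation. Since the trace vanishes, it lies in
  \<open>W\<close> as soon as \<open>v \<bullet> X u = v \<bullet> X w = 0\<close> and \<open>w\<close> is isotropic, that is \<open>w \<bullet> X w = 0\<close>.

  Such a frame exists because the quadratic form of a trace-free matrix is never definite: its
  maximum \<open>a\<close> and minimum \<open>c\<close> on the unit sphere satisfy \<open>c \<le> 0 \<le> a\<close>, and they are eigenvalues,
  with unit eigenvectors \<open>p\<close> and \<open>q\<close>. If \<open>a = c\<close>, then \<open>X = 0\<close>. Otherwise \<open>p\<close> and \<open>q\<close> are
  orthogonal, and somewhere on the arc from \<open>p\<close> to \<open>q\<close> the form vanishes; this point is \<open>w\<close>. A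
  unit vector orthogonal to it in the \<open>X\<close>-invariant plane of \<open>p\<close> and \<open>q\<close> is \<open>u\<close>, and
  \<open>v = w \<times> u\<close> is the normal of that plane. Thus \<open>v\<close> belongs to the middle eigenvalue, the one choice for which the form
  on the orthogonal complement is sure not to be definite.
\<close>

unbundle cross3_syntax

section \<open>Extreme eigenvectors of self-adjoint maps\<close>

text \<open>
  For a positive semidefinite form, a null vector minimises the form, so its derivative \<open>2 f x\<close>
  vanishes there. The proof compares \<open>x\<close> with a point reached by moving against the gradient.
\<close>

lemma selfadjoint_nonneg_null_vector:
  fixes f :: "'a::real_inner \<Rightarrow> 'a"
  assumes "linear f"
    and selfadj: "\<And>x y. x \<bullet> f y = f x \<bullet> y"
    and nonneg: "\<And>y. 0 \<le> y \<bullet> f y"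
    and null: "x \<bullet> f x = 0"
  shows "f x = 0"
proof -
  define n where "n = f x \<bullet> f x"
  define d where "d = f x \<bullet> f (f x)"
  define t where "t = n / (d + 1)"
  have d: "0 \<le> d"
    unfolding d_def by (rule nonneg)
  then have n: "n = t * (d + 1)"
    by (simp add: t_def)
  have "0 \<le> (x - t *\<^sub>R f x) \<bullet> f (x - t *\<^sub>R f x)"
    by (rule nonneg)
  also have "\<dots> = t\<^sup>2 * d - 2 * t * n"
    using null selfadj[of x "f x"]
    by (simp add: linear_diff[OF \<open>linear f\<close>] linear_cmul[OF \<open>linear f\<close>] inner_diff_left
        inner_diff_right n_def d_def power2_eq_square algebra_simps)
  also have "\<dots> = - (t\<^sup>2 * (d + 2))"
    by (simp add: n power2_eq_square algebra_simps)
  finally have "t = 0"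
    using d by (simp add: mult_le_0_iff)
  then have "n = 0"
    using n by simp
  then show ?thesis
    by (simp add: n_def)
qed

text \<open>
  The maximum \<open>a\<close> of the form on the compact unit sphere makes \<open>a y - f y\<close> positive semidefinite,
  with every maximiser as a null vector.
\<close>

lemma selfadjoint_max_eigenvector:
  fixes f :: "'a::euclidean_space \<Rightarrow> 'a"
  assumes "linear f"
    and selfadj: "\<And>x y. x \<bullet> f y = f x \<bullet> y"
  obtains p a where "norm p = 1" "f p = a *\<^sub>R p" "\<And>y. y \<bullet> f y \<le> a * (y \<bullet> y)"
proof -
  have "continuous_on (sphere 0 1) (\<lambda>y. y \<bullet> f y)"
    by (intro continuous_intros linear_continuous_on linear_conv_bounded_linear[THEN iffD1] assms)
  moreover have "sphere (0::'a) 1 \<noteq> {}"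
    by simp
  ultimately obtain p where p: "norm p = 1"
    and p_max: "\<And>y. norm y = 1 \<Longrightarrow> y \<bullet> f y \<le> p \<bullet> f p"
    using continuous_attains_sup[of "sphere (0::'a) 1" "\<lambda>y. y \<bullet> f y"] by auto
  define a where "a = p \<bullet> f p"
  have bound: "y \<bullet> f y \<le> a * (y \<bullet> y)" for y
  proof (cases "y = 0")
    case False
    define z where "z = y /\<^sub>R norm y"
    have y: "y = norm y *\<^sub>R z"
      using False by (simp add: z_def)
    have "y \<bullet> f y = (norm y)\<^sup>2 * (z \<bullet> f z)"
      by (subst (1 2) y) (simp add: linear_cmul[OF \<open>linear f\<close>] power2_eq_square)
    also have "\<dots> \<le> (norm y)\<^sup>2 * a"
      unfolding a_def using False by (intro mult_left_mono p_max) (auto simp: z_def)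
    finally show ?thesis
      by (simp add: power2_norm_eq_inner mult.commute)
  qed simp
  have "a *\<^sub>R p - f p = 0"
  proof (rule selfadjoint_nonneg_null_vector[where f = "\<lambda>y. a *\<^sub>R y - f y"])
    show "linear (\<lambda>y. a *\<^sub>R y - f y)"
      using \<open>linear f\<close> by (intro linear_compose_sub linear_scale_self)
    show "x \<bullet> (a *\<^sub>R y - f y) = (a *\<^sub>R x - f x) \<bullet> y" for x y
      by (simp add: inner_diff_left inner_diff_right selfadj)
    show "0 \<le> y \<bullet> (a *\<^sub>R y - f y)" for y
      using bound[of y] by (simp add: inner_diff_right)
    show "p \<bullet> (a *\<^sub>R p - f p) = 0"
      using p by (simp add: inner_diff_right a_def norm_eq_1)
  qed
  with p bound show thesis
    by (intro that[of p a]) auto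
qed

lemma trace_eq_sum_axis:
  fixes X :: "real^'n^'n"
  shows "trace X = (\<Sum>i\<in>UNIV. axis i 1 \<bullet> (X *v axis i 1))"
  by (simp add: trace_def inner_axis' matrix_vector_mult_basis column_def)

lemma symmetric_matrix_selfadjoint:
  fixes X :: "real^'n^'n"
  assumes "transpose X = X"
  shows "x \<bullet> (X *v y) = (X *v x) \<bullet> y"
  by (metis assms dot_lmul_matrix vector_transpose_matrix)

section \<open>Conjugation by rotations\<close>

lemma matrix_inv_orthogonal:
  fixes k :: "real^'n^'n"
  assumes "orthogonal_matrix k"
  shows "matrix_inv k = transpose k"
proof -
  have "\<exists>k'. k ** k' = mat 1 \<and> k' ** k = mat 1"
    using assms unfolding orthogonal_matrix_def by blast
  then have "matrix_inv k ** k = mat 1"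
    unfolding matrix_inv_def by (rule someI2_ex) simp
  then have "matrix_inv k ** (k ** transpose k) = transpose k"
    by (simp add: matrix_mul_assoc)
  then show ?thesis
    using assms by (simp add: orthogonal_matrix_def)
qed

lemma conj_act_SO3:
  assumes "k \<in> SO3"
  shows "conj_act k X = k ** X ** transpose k"
  using assms by (simp add: SO3_def rotation_matrix_def conj_act_def matrix_inv_orthogonal)

lemma conj_act_sym0:
  assumes "k \<in> SO3" and "X \<in> sym0"
  shows "conj_act k X \<in> sym0"
proof -
  have k: "transpose k ** k = mat 1"
    using assms(1) by (simp add: SO3_def rotation_matrix_def orthogonal_matrix)
  have "trace (k ** X ** transpose k) = trace X"
    by (metis k matrix_mul_assoc matrix_mul_lid trace_mul_sym)
  with assms show ?thesis
    by (simp add: conj_act_SO3 sym0_def matrix_transpose_mul matrix_mul_assoc)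
qed

lemma W_sub_subset_sym0: "W_sub \<subseteq> sym0"
  by (auto simp: W_sub_def W_mat_def sym0_def trace_def sum_3 transpose_def vec_eq_iff forall_3)

lemma matrix_conj_transpose_component:
  fixes R X :: "real^'n^'n"
  shows "(R ** X ** transpose R) $ i $ j = R $ i \<bullet> (X *v R $ j)"
proof -
  have "(R ** X ** transpose R) $ i $ j = (R ** (X ** transpose R)) $ i $ j"
    by (simp add: matrix_mul_assoc)
  also have "\<dots> = R $ i \<bullet> (X *v R $ j)"
    by (simp add: matrix_matrix_mult_def matrix_vector_mult_def transpose_def inner_vec_def)
  finally show ?thesis .
qed

text \<open>
  The entries of the conjugated matrix are read off in the frame \<open>u, v, w\<close>, and the trace determines
  the first diagonal entry from the second.
\<close>

lemma adapted_frame_imp_saturation: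
  assumes X: "X \<in> sym0"
    and unit: "norm u = 1" "norm w = 1" and uw: "u \<bullet> w = 0"
    and v: "v = w \<times> u"
    and vu: "v \<bullet> (X *v u) = 0" and vw: "v \<bullet> (X *v w) = 0"
    and ww: "w \<bullet> (X *v w) = 0"
  shows "X \<in> saturation W_sub"
proof -
  define R :: "real^3^3" where "R = vector [u, v, w]"
  have R: "R $ 1 = u" "R $ 2 = v" "R $ 3 = w"
    by (simp_all add: R_def)
  have unit': "u \<bullet> u = 1" "w \<bullet> w = 1"
    using unit by (simp_all add: norm_eq_1)
  have vv: "v \<bullet> v = 1"
    using uw unit' by (simp add: v dot_cross inner_commute)
  have ortho: "u \<bullet> v = 0" "v \<bullet> w = 0"
    by (simp_all add: v dot_cross_self)
  have RR: "R ** transpose R = mat 1"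
    unfolding matrix_mult_transpose_dot_row
    using unit' vv uw ortho
    by (simp add: vec_eq_iff forall_3 mat_def row_def R inner_commute)
  have "det R = u \<bullet> (v \<times> w)"
    by (simp add: R_def dot_cross_det)
  also have "\<dots> = v \<bullet> v"
    using cross_triple[of v w u] cross_triple[of w u v] by (simp add: v inner_commute)
  finally have "rotation_matrix (transpose R)"
    using RR vv by (simp add: rotation_matrix_def orthogonal_matrix_def matrix_left_right_inverse)
  then have K: "transpose R \<in> SO3"
    by (simp add: SO3_def)
  define Y where "Y = R ** X ** transpose R"
  have RR': "transpose R ** R = mat 1"
    using RR matrix_left_right_inverse by blast
  have XY: "X = conj_act (transpose R) Y"
  proof -
    have "conj_act (transpose R) Y = (transpose R ** R) ** X ** (transpose R ** R)"
      by (simp add: conj_act_SO3[OF K] Y_def matrix_mul_assoc)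
    then show ?thesis
      by (simp add: RR')
  qed
  have "trace Y = trace X"
    by (metis RR' Y_def matrix_mul_assoc matrix_mul_lid trace_mul_sym)
  then have tr: "u \<bullet> (X *v u) = - (v \<bullet> (X *v v))"
    using X ww by (simp add: sym0_def trace_def sum_3 Y_def matrix_conj_transpose_component R)
  have symm: "x \<bullet> (X *v y) = y \<bullet> (X *v x)" for x y
    using X symmetric_matrix_selfadjoint[of X x y] by (simp add: sym0_def inner_commute)
  have "Y = W_mat (u \<bullet> (X *v u)) (u \<bullet> (X *v w))"
    using vu vw ww tr symm[of u v] symm[of w v] symm[of w u]
    by (simp add: vec_eq_iff forall_3 W_mat_def Y_def matrix_conj_transpose_component R)
  then have "Y \<in> W_sub"
    unfolding W_sub_def by blast
  with XY K show ?thesis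
    unfolding saturation_def by blast
qed

section \<open>Trace-free symmetric matrices\<close>

lemma sym0_extreme_eigenvectors:
  assumes "X \<in> sym0"
  obtains p q a c where "norm p = 1" "norm q = 1" "X *v p = a *\<^sub>R p" "X *v q = c *\<^sub>R q"
    "c \<le> 0" "0 \<le> a" "\<And>y. c * (y \<bullet> y) \<le> y \<bullet> (X *v y)" "\<And>y. y \<bullet> (X *v y) \<le> a * (y \<bullet> y)"
proof -
  have selfadj: "x \<bullet> (X *v y) = (X *v x) \<bullet> y" for x y
    using assms symmetric_matrix_selfadjoint[of X x y] by (simp add: sym0_def)
  obtain p a where p: "norm p = 1" "X *v p = a *\<^sub>R p" "\<And>y. y \<bullet> (X *v y) \<le> a * (y \<bullet> y)"
    using selfadjoint_max_eigenvector[of "(*v) X"] selfadj by auto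
  have neg_linear: "linear (\<lambda>y. - (X *v y))"
    by (intro linear_compose_neg matrix_vector_mul_linear)
  have neg_selfadj: "x \<bullet> - (X *v y) = - (X *v x) \<bullet> y" for x y
    by (simp add: selfadj)
  obtain q b where q: "norm q = 1" "- (X *v q) = b *\<^sub>R q" "\<And>y. y \<bullet> - (X *v y) \<le> b * (y \<bullet> y)"
    using selfadjoint_max_eigenvector[OF neg_linear neg_selfadj] by blast
  have lower: "- b * (y \<bullet> y) \<le> y \<bullet> (X *v y)" for y
    using q(3)[of y] by simp
  \<comment> \<open>The trace is the sum of the values of the form on the standard basis, so it lies between \<open>3 c\<close>
    and \<open>3 a\<close>.\<close>
  have tr: "(\<Sum>i\<in>UNIV. axis i 1 \<bullet> (X *v axis i 1)) = 0"
    using assms by (simp add: sym0_def flip: trace_eq_sum_axis)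
  have "0 \<le> a" "- b \<le> 0"
    using tr p(3)[of "axis 1 1"] p(3)[of "axis 2 1"] p(3)[of "axis 3 1"]
      lower[of "axis 1 1"] lower[of "axis 2 1"] lower[of "axis 3 1"]
    by (simp_all add: sum_3 inner_axis_axis)
  moreover have "X *v q = (- b) *\<^sub>R q"
    using q(2) by (metis minus_equation_iff scaleR_minus_left)
  ultimately show thesis
    using p q(1) lower by (intro that[of p q a "- b"]) auto
qed

lemma sym0_subset_saturation: "sym0 \<subseteq> saturation W_sub"
proof
  fix X assume X: "X \<in> sym0"
  have selfadj: "x \<bullet> (X *v y) = (X *v x) \<bullet> y" for x y
    using X symmetric_matrix_selfadjoint[of X x y] by (simp add: sym0_def)
  obtain p q a c where pq: "norm p = 1" "norm q = 1"
    and eig: "X *v p = a *\<^sub>R p" "X *v q = c *\<^sub>R q"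
    and sgn: "c \<le> 0" "0 \<le> a"
    and bounds: "\<And>y. c * (y \<bullet> y) \<le> y \<bullet> (X *v y)" "\<And>y. y \<bullet> (X *v y) \<le> a * (y \<bullet> y)"
    using sym0_extreme_eigenvectors[OF X] by blast
  show "X \<in> saturation W_sub"
  proof (cases "a = c")
    case True
    with sgn have "a = 0" "c = 0"
      by auto
    then have form: "y \<bullet> (X *v y) = 0" for y
      using bounds[of y] by simp
    have zero: "X *v y = 0" for y
      by (rule selfadjoint_nonneg_null_vector[where f = "(*v) X"])
        (use selfadj form in auto)
    show ?thesis
      by (rule adapted_frame_imp_saturation[OF X,
          where u = "axis 1 1" and w = "axis 2 1", OF _ _ _ refl])
        (simp_all add: zero inner_axis_axis)
  next
    case False
    with sgn have ac: "0 < a - c"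
      by auto
    have "a * (p \<bullet> q) = c * (p \<bullet> q)"
      using selfadj[of p q] by (auto simp: eig)
    with False have "p \<bullet> q = 0"
      by simp
    then have orth: "p \<bullet> q = 0" "q \<bullet> p = 0"
      by (simp_all add: inner_commute)
    have unit: "p \<bullet> p = 1" "q \<bullet> q = 1"
      using pq by (simp_all add: norm_eq_1)
    \<comment> \<open>On the arc \<open>w = s p + t q\<close> with \<open>s\<^sup>2 + t\<^sup>2 = 1\<close> the form is \<open>a s\<^sup>2 + c t\<^sup>2\<close>;
      these coefficients make it vanish.\<close>
    define s where "s = sqrt (- c / (a - c))"
    define t where "t = sqrt (a / (a - c))"
    have s2: "s * s = - c / (a - c)" and t2: "t * t = a / (a - c)"
      unfolding s_def t_def using sgn ac by (simp_all add: divide_nonpos_pos)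
    have st1: "s * s + t * t = 1"
      unfolding s2 t2 using ac by (simp flip: diff_divide_distrib)
    have st0: "a * (s * s) + c * (t * t) = 0"
      unfolding s2 t2 by simp
    define u where "u = t *\<^sub>R p - s *\<^sub>R q"
    define w where "w = s *\<^sub>R p + t *\<^sub>R q"
    have Xu: "X *v u = (t * a) *\<^sub>R p - (s * c) *\<^sub>R q"
      by (simp add: u_def matrix_vector_mult_diff_distrib matrix_vector_mult_scaleR eig)
    have Xw: "X *v w = (s * a) *\<^sub>R p + (t * c) *\<^sub>R q"
      by (simp add: w_def matrix_vector_right_distrib matrix_vector_mult_scaleR eig)
    have normal: "(w \<times> u) \<bullet> p = 0" "(w \<times> u) \<bullet> q = 0"
      by (simp_all add: u_def w_def Cross3.right_diff_distrib cross_add_left cross_mult_left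
          cross_mult_right dot_cross_self inner_diff_left inner_add_left)
    show ?thesis
    proof (rule adapted_frame_imp_saturation[OF X, where u = u and w = w, OF _ _ _ refl])
      show "norm u = 1" "norm w = 1"
        using st1 by (simp_all add: norm_eq_1 u_def w_def inner_simps unit orth add.commute)
      show "u \<bullet> w = 0"
        by (simp add: u_def w_def inner_simps unit orth)
      show "(w \<times> u) \<bullet> (X *v u) = 0" "(w \<times> u) \<bullet> (X *v w) = 0"
        by (simp_all add: Xu Xw inner_diff_right inner_add_right normal)
      show "w \<bullet> (X *v w) = 0"
        unfolding Xw using st0
        by (simp add: w_def inner_simps unit orth algebra_simps)
    qed
  qed
qed

theorem theorem1p1:
  shows "saturation W_sub = sym0"
proof
  show "saturation W_sub \<subseteq> sym0"
    using W_sub_subset_sym0 conj_act_sym0 by (auto simp: saturation_def)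
  show "sym0 \<subseteq> saturation W_sub"
    by (rule sym0_subset_saturation)
qed

end
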